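(* Let $d\ge2$, let $f:\mathbb{R}^d\to\mathbb{R}$ be a $C^1$ function, and for $1\le i\le d$ let $K_i\subset\mathbb{R}$ be a Cantor set with convex hull $[A_i,B_i]$. Let $D=[A_1,B_1]\times\cdots\times[A_d,B_d]$, assume that $\left|\frac{\partial f}{\partial x_i}\right|>0$ on $D$ for all $1\le i\le d$, and put $$L_i=\max_{x\in D}\left|\frac{\partial f}{\partial x_i}(x)\right|,\quad S_i=\min_{x\in D}\left|\frac{\partial f}{\partial x_i}(x)\right|,\quad r_i=\frac{L_i}{S_i}.$$ If one of the following conditions is satisfied: (1) $L_i\le\sum_{j\neq i}S_j\,\tau(K_j)$ for all $1\le i\le d$; (2) $\displaystyle\sum_{i=1}^d\frac{\tau(K_i)}{\tau(K_i)+r_i}\ge1$; then $f(K_1,\dots,K_d)=\{f(x_1,\dots,x_d):x_i\in K_i,\ 1\le i\le d\}$ is a union of finitely many closed intervals.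
   Context: Thickness. Let $K\subset\mathbb{R}$ be a Cantor set with convex hull $I$. The gaps of $K$ are the bounded connected components of $\mathbb{R}\setminus K$; they are enumerated as $(O_n)_{n\ge1}$ with non-increasing lengths $|O_n|$ (ties ordered arbitrarily). For each $n$, let $I_n$ be the connected component of $I\setminus(O_1\cup\cdots\cup O_{n-1})$ containing $O_n$, and let $L_n',R_n'$ be the left and right closed intervals of $I_n\setminus O_n$ (called bridges). Then $$\tau(K)=\inf_{n}\frac{\min\{|L_n'|,|R_n'|\}}{|O_n|}.$$ It is always assumed that there are infinitely many gaps and that $K$ has no isolated points. *)

theory Defs
  imports "HOL-Analysis.Analysis"
begin

definition cantor_set :: "real set \<Rightarrow> bool" where
  "cantor_set K \<longleftrightarrow>
     K \<noteq> {} \<and> compact K \<and> (\<forall>x\<in>K. x islimpt K) \<and>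
     (\<forall>C. C \<subseteq> K \<and> connected C \<longrightarrow> (\<exists>x. C \<subseteq> {x}))"

definition gaps :: "real set \<Rightarrow> real set set" where
  "gaps K = {C \<in> components (- K). bounded C}"

abbreviation len :: "real set \<Rightarrow> real" where
  "len J \<equiv> measure lborel J"

text \<open>The enumeration starts at index \<open>0\<close>.\<close>

definition gap_enumeration :: "real set \<Rightarrow> (nat \<Rightarrow> real set) \<Rightarrow> bool" where
  "gap_enumeration K G \<longleftrightarrow>
     bij_betw G UNIV (gaps K) \<and> (\<forall>m n. m \<le> n \<longrightarrow> len (G n) \<le> len (G m))"

definition gap_host :: "real set \<Rightarrow> (nat \<Rightarrow> real set) \<Rightarrow> nat \<Rightarrow> real set" where
  "gap_host K G n =
     (THE C. C \<in> components (convex hull K - (\<Union>m<n. G m)) \<and> G n \<subseteq> C)"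

text \<open>If \<^term>\<open>gap_host K G n\<close> is the interval \<open>[a, b]\<close> and \<^term>\<open>G n\<close> is \<open>(c, d)\<close>,
  then the bridges are \<open>[a, c]\<close> and \<open>[d, b]\<close>.\<close>

definition left_bridge :: "real set \<Rightarrow> (nat \<Rightarrow> real set) \<Rightarrow> nat \<Rightarrow> real set" where
  "left_bridge K G n = {x \<in> gap_host K G n. \<forall>y\<in>G n. x < y}"

definition right_bridge :: "real set \<Rightarrow> (nat \<Rightarrow> real set) \<Rightarrow> nat \<Rightarrow> real set" where
  "right_bridge K G n = {x \<in> gap_host K G n. \<forall>y\<in>G n. y < x}"

text \<open>Gaps of equal length may be listed in any order, so the enumeration is an arbitrary choice.
  A Cantor set has infinitely many gaps, with finite total length, so an enumeration exists. The
  infimum is over nonnegative numbers.\<close>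

definition thickness :: "real set \<Rightarrow> real" where
  "thickness K =
     (let G = (SOME G. gap_enumeration K G)
      in INF n. min (len (left_bridge K G n)) (len (right_bridge K G n)) / len (G n))"

definition C1 :: "(real ^ 'n \<Rightarrow> real) \<Rightarrow> bool" where
  "C1 f \<longleftrightarrow>
     (\<exists>f' :: real ^ 'n \<Rightarrow> ((real ^ 'n) \<Rightarrow>\<^sub>L real).
        (\<forall>x. (f has_derivative blinfun_apply (f' x)) (at x)) \<and> continuous_on UNIV f')"

definition partial_deriv :: "'n::finite \<Rightarrow> (real ^ 'n \<Rightarrow> real) \<Rightarrow> real ^ 'n \<Rightarrow> real" where
  "partial_deriv i f x = deriv (\<lambda>t. f (x + t *\<^sub>R axis i 1)) 0"

text \<open>For \<^prop>\<open>C1 f\<close> and a nonempty compact \<^term>\<open>D\<close>, the supremum and infimum below are attained,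
  i.e. they are a maximum and a minimum.\<close>

definition max_partial :: "(real ^ 'n \<Rightarrow> real) \<Rightarrow> (real ^ 'n) set \<Rightarrow> 'n::finite \<Rightarrow> real" where
  "max_partial f D i = (SUP x\<in>D. \<bar>partial_deriv i f x\<bar>)"

definition min_partial :: "(real ^ 'n \<Rightarrow> real) \<Rightarrow> (real ^ 'n) set \<Rightarrow> 'n::finite \<Rightarrow> real" where
  "min_partial f D i = (INF x\<in>D. \<bar>partial_deriv i f x\<bar>)"

end

theory Submission
  imports Defs
begin

text \<open>
  Thickness controls how gaps are spaced: between two gaps of a Cantor set of thickness \<open>\<tau>\<close> there is
  room for \<open>\<tau>\<close> times the shorter one (\<open>cantor_set_thick\<close>). Reflecting coordinates, let \<open>f\<close> be
  increasing in every variable, and call \<open>\<omega>\<^sub>i l\<close> the weight of a gap of length \<open>l\<close> of \<open>K\<^sub>i\<close>, for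
  positive numbers \<open>\<omega>\<^sub>i\<close> to be chosen. Removing all gaps of weight at least a small \<open>\<delta>\<close> cuts each hull
  into finitely many pieces, hence the domain into finitely many boxes. It is enough to show that
  the part of the product of the \<open>K\<^sub>i\<close> in such a box with lowest corner \<open>a\<close> and highest corner \<open>b\<close>
  is mapped onto all of \<open>[f a, f b]\<close>.

  Fix a value \<open>t\<close> in this interval and remove further gaps from the box one by one, always a gap
  of maximal weight, keeping the half whose corner values still enclose \<open>t\<close>. Such a half exists if
  the value at the lowest corner of the upper half does not exceed that at the highest corner of the
  lower half (\<open>halves_overlap\<close>). For a gap of weight \<open>M\<close> in direction \<open>i\<close> the drop of \<open>f\<close> across it is
  at most \<open>L\<^sub>i M / \<omega>\<^sub>i\<close>. The sides of the box end at gaps that were removed earlier, thus have weight at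
  least \<open>M\<close>, so side \<open>j\<close> is at least \<open>\<tau>\<^sub>j M / \<omega>\<^sub>j\<close> long (\<open>ends_apart\<close>) and contributes \<open>S\<^sub>j\<close> times this
  to the rise of \<open>f\<close>. The cut is therefore possible if
  \<open>L\<^sub>i \<le> \<omega>\<^sub>i \<Sum>\<^sub>j\<^sub>\<noteq>\<^sub>i S\<^sub>j \<tau>\<^sub>j / \<omega>\<^sub>j\<close>. Each of the two conditions of the theorem provides weights with this
  property: \<open>\<omega>\<^sub>i = 1\<close> for the first and \<open>\<omega>\<^sub>i = S\<^sub>i \<tau>\<^sub>i + L\<^sub>i\<close> for the second (\<open>balancing_weights\<close>).

  Once all gaps of weight at least \<open>s\<close> are gone, \<open>t\<close> is a value of \<open>f\<close> at a point whose distance from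
  the product of the \<open>K\<^sub>i\<close> is of order \<open>s\<close>. Letting \<open>s\<close> tend to \<open>0\<close>, compactness gives \<open>t\<close> as a value on the
  product itself (\<open>box_image\<close>).
\<close>

section \<open>Gaps and their separation\<close>

text \<open>Gaps as pairs of end points in \<^term>\<open>K\<close>: cutting and reflecting a set act on the end points
  directly.\<close>

definition is_gap :: "real set \<Rightarrow> real \<Rightarrow> real \<Rightarrow> bool" where
  "is_gap K c d \<longleftrightarrow> c \<in> K \<and> d \<in> K \<and> c < d \<and> {c<..<d} \<inter> K = {}"

text \<open>All that the argument needs from a Cantor set of thickness \<open>\<tau>\<close> with hull \<open>[A, B]\<close>: two gaps, or a gap
  and an end of the hull, are separated by at least \<open>\<tau>\<close> times the shorter one, the unbounded
  components of the complement counting as infinitely long. The strict inequalities say that no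
  point of \<^term>\<open>K\<close> is isolated. In contrast to the definition by bridges, no enumeration occurs here,
  and the property is visibly invariant under reflection.\<close>

definition thick :: "real set \<Rightarrow> real \<Rightarrow> real \<Rightarrow> real \<Rightarrow> bool" where
  "thick K A B \<tau> \<longleftrightarrow> compact K \<and> K \<subseteq> {A..B} \<and> A \<in> K \<and> B \<in> K \<and> A < B \<and> \<tau> \<ge> 0 \<and>
     (\<forall>c d. is_gap K c d \<longrightarrow> A < c \<and> d < B \<and> \<tau> * (d - c) \<le> c - A \<and> \<tau> * (d - c) \<le> B - d) \<and>
     (\<forall>c d c' d'. is_gap K c d \<and> is_gap K c' d' \<and> d \<le> c' \<longrightarrow>
        d < c' \<and> \<tau> * min (d - c) (d' - c') \<le> c' - d)"

text \<open>The end points are the points of \<^term>\<open>K\<close> nearest to \<^term>\<open>z\<close> on its two sides.\<close>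

lemma gap_around:
  assumes "closed K" "x \<in> K" "y \<in> K" "x \<le> z" "z \<le> y" "z \<notin> K"
  obtains c d where "is_gap K c d" "x \<le> c" "c < z" "z < d" "d \<le> y"
proof -
  let ?c = "Sup (K \<inter> {x..z})" and ?d = "Inf (K \<inter> {z..y})"
  have c: "?c \<in> K \<inter> {x..z}"
    using assms by (intro closed_contains_Sup) auto
  have d: "?d \<in> K \<inter> {z..y}"
    using assms by (intro closed_contains_Inf) auto
  have no: "w \<notin> K" if "?c < w" "w < ?d" for w
  proof
    assume w: "w \<in> K"
    show False
    proof (cases "w \<le> z")
      case True
      with w c that(1) have "w \<in> K \<inter> {x..z}" by auto
      then have "w \<le> ?c" by (intro cSup_upper) auto
      with that show False by simp
    next
      case False
      with w d that(2) have "w \<in> K \<inter> {z..y}" by auto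
      then have "?d \<le> w" by (intro cInf_lower) auto
      with that show False by simp
    qed
  qed
  have "?c \<noteq> z" "?d \<noteq> z" using c d assms by (metis IntD1)+
  with c d have lt: "?c < z" "z < ?d" by auto
  then have "is_gap K ?c ?d" unfolding is_gap_def using c d no by auto
  then show ?thesis using that c d lt by auto
qed

lemma is_gap_in_gaps:
  assumes "is_gap K c d"
  shows "{c<..<d} \<in> gaps K"
proof -
  have sub: "{c<..<d} \<subseteq> - K" and ne: "{c<..<d} \<noteq> {}"
    using assms by (auto simp: is_gap_def)
  have "{c<..<d} \<in> components (- K)"
    unfolding in_components_maximal
  proof (intro conjI allI impI)
    fix X assume X: "X \<noteq> {} \<and> {c<..<d} \<subseteq> X \<and> X \<subseteq> - K \<and> connected X"
    have cd: "c \<notin> X" "d \<notin> X" using X assms by (auto simp: is_gap_def)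
    obtain z where z: "c < z" "z < d" using assms dense[of c d] by (auto simp: is_gap_def)
    have zX: "z \<in> X" using z X by auto
    show "X = {c<..<d}"
    proof (intro equalityI subsetI)
      fix x assume x: "x \<in> X"
      have "c < x"
      proof (rule ccontr)
        assume "\<not> c < x"
        with X x zX z have "c \<in> X" using connectedD_interval[of X x z c] by auto
        with cd show False by simp
      qed
      moreover have "x < d"
      proof (rule ccontr)
        assume "\<not> x < d"
        with X x zX z have "d \<in> X" using connectedD_interval[of X z x d] by auto
        with cd show False by simp
      qed
      ultimately show "x \<in> {c<..<d}" by simp
    qed (use X in auto)
  qed (use sub ne in auto)
  then show ?thesis by (simp add: gaps_def)
qed

lemma gaps_are_gap_intervals:
  assumes "compact K" "O' \<in> gaps K"
  obtains c d where "is_gap K c d" "O' = {c<..<d}"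
proof -
  have C: "O' \<in> components (- K)" "bounded O'" using assms(2) by (auto simp: gaps_def)
  obtain z where z: "z \<in> O'" using C(1) in_components_nonempty by blast
  have zK: "z \<notin> K" using z C(1) in_components_subset by fastforce
  have "\<exists>x\<in>K. x \<le> z"
  proof (rule ccontr)
    assume "\<not> ?thesis"
    then have "{..z} \<subseteq> - K" by fastforce
    then have "{..z} \<subseteq> O'"
      using C(1) z components_maximal[of O' "- K" "{..z}"] by auto
    then have "bdd_below {..z}" by (rule bdd_below_mono[OF bounded_imp_bdd_below[OF C(2)]])
    then obtain m where "\<And>u. u \<le> z \<Longrightarrow> m \<le> u" by (auto simp: bdd_below_def)
    from this[of "min z (m - 1)"] show False by linarith
  qed
  then obtain x where x: "x \<in> K" "x \<le> z" by blast
  have "\<exists>x\<in>K. z \<le> x"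
  proof (rule ccontr)
    assume "\<not> ?thesis"
    then have "{z..} \<subseteq> - K" by fastforce
    then have "{z..} \<subseteq> O'"
      using C(1) z components_maximal[of O' "- K" "{z..}"] by auto
    then have "bdd_above {z..}" by (rule bdd_above_mono[OF bounded_imp_bdd_above[OF C(2)]])
    then obtain m where "\<And>u. z \<le> u \<Longrightarrow> u \<le> m" by (auto simp: bdd_above_def)
    from this[of "max z (m + 1)"] show False by linarith
  qed
  then obtain y where y: "y \<in> K" "z \<le> y" by blast
  obtain c d where cd: "is_gap K c d" "c < z" "z < d"
    using gap_around[OF compact_imp_closed[OF assms(1)] x(1) y(1) x(2) y(2) zK] by blast
  have "{c<..<d} \<in> components (- K)" using is_gap_in_gaps[OF cd(1)] by (simp add: gaps_def)
  then have "O' = {c<..<d}"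
    using components_eq[OF C(1)] z cd(2,3) by fastforce
  with cd(1) show ?thesis using that by blast
qed

lemma cantor_infinite:
  assumes "cantor_set K" shows "infinite K"
  using assms islimpt_finite unfolding cantor_set_def by blast

lemma gap_between:
  assumes "cantor_set K" "x \<in> K" "y \<in> K" "x < y"
  obtains c d where "is_gap K c d" "x \<le> c" "d \<le> y"
proof -
  have "\<not> {x..y} \<subseteq> K"
  proof
    assume "{x..y} \<subseteq> K"
    then obtain u where "{x..y} \<subseteq> {u}"
      using assms(1) connected_Icc unfolding cantor_set_def by blast
    moreover have "x \<in> {x..y}" "y \<in> {x..y}" using assms(4) by auto
    ultimately show False using assms(4) by (metis less_irrefl singletonD subsetD)
  qed
  then have "\<exists>z. x \<le> z \<and> z \<le> y \<and> z \<notin> K" by auto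
  then obtain z where "x \<le> z" "z \<le> y" "z \<notin> K" by blast
  then show ?thesis
    using gap_around[of K x y z] assms that compact_imp_closed
    unfolding cantor_set_def by metis
qed

section \<open>Enumerating the gaps\<close>

text \<open>Every two points of \<^term>\<open>K\<close> are separated by a gap, so a point is determined by the number of
  right gap ends to its left. With finitely many gaps this would embed \<^term>\<open>K\<close> into a finite set.\<close>

lemma infinite_gaps:
  assumes "cantor_set K"
  shows "infinite (gaps K)"
proof
  assume fin: "finite (gaps K)"
  define E where "E = Sup ` gaps K"
  have finE: "finite E" using fin by (simp add: E_def)
  define h where "h y = card {e \<in> E. e \<le> y}" for y
  have lt: "h x < h y" if xy: "x \<in> K" "y \<in> K" "x < y" for x y
  proof -
    obtain c d where cd: "is_gap K c d" "x \<le> c" "d \<le> y"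
      using gap_between[OF assms xy] by blast
    have cltd: "c < d" using cd(1) by (simp add: is_gap_def)
    then have "Sup {c<..<d} = d" by simp
    then have "d \<in> E" using is_gap_in_gaps[OF cd(1)] unfolding E_def by (metis imageI)
    then have "{e \<in> E. e \<le> x} \<subset> {e \<in> E. e \<le> y}"
      using cd cltd by force
    then show ?thesis unfolding h_def using finE by (intro psubset_card_mono) auto
  qed
  have "inj_on h K"
  proof (rule inj_onI)
    fix x y assume "x \<in> K" "y \<in> K" "h x = h y"
    then show "x = y" using lt by (metis less_irrefl linorder_neqE)
  qed
  moreover have "h ` K \<subseteq> {..card E}"
    unfolding h_def using finE by (auto intro!: card_mono)
  ultimately have "finite K" by (meson finite_atMost finite_imageD finite_subset)
  with cantor_infinite[OF assms] show False by simp
qed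

text \<open>Gaps are disjoint subintervals of a bounded interval, so their lengths have a bounded sum.\<close>

lemma finite_long_gaps:
  assumes "compact K" "\<epsilon> > 0"
  shows "finite {O' \<in> gaps K. \<epsilon> \<le> len O'}"
proof (cases "K = {}")
  case True
  have "False" if gap: "O' \<in> gaps K" for O'
    using gaps_are_gap_intervals[OF assms(1) gap] True by (auto simp: is_gap_def)
  then have "gaps K = {}" by blast
  then show ?thesis by simp
next
  case False
  obtain A B where AB: "K \<subseteq> {A..B}"
    using assms(1) by (metis bounded_subset_cbox_symmetric compact_imp_bounded cbox_interval)
  then have AleB: "A \<le> B" using False by fastforce
  show ?thesis
  proof (rule conjunct1[OF finite_if_finite_subsets_card_bdd])
    fix F assume F: "F \<subseteq> {O' \<in> gaps K. \<epsilon> \<le> len O'}" "finite F"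
    have fm: "O' \<in> fmeasurable lborel \<and> O' \<subseteq> {A..B}" if OF: "O' \<in> F" for O'
    proof -
      obtain c d where "is_gap K c d" "O' = {c<..<d}"
        using gaps_are_gap_intervals[OF assms(1)] F OF by blast
      with AB show ?thesis by (force simp: is_gap_def fmeasurable_def)
    qed
    have disj: "disjoint F"
    proof (rule disjointI)
      fix a b assume "a \<in> F" "b \<in> F" "a \<noteq> b"
      then show "a \<inter> b = {}"
        using F components_nonoverlap[of a "- K" b] by (auto simp: gaps_def)
    qed
    have "\<epsilon> * card F = (\<Sum>O'\<in>F. \<epsilon>)" by simp
    also have "\<dots> \<le> (\<Sum>O'\<in>F. len O')" using F by (intro sum_mono) auto
    also have "\<dots> = len (\<Union>F)"
      using measure_Union'[OF F(2), of lborel] fm disj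
      by (auto simp: pairwise_def disjoint_def disjnt_def)
    also have "\<dots> \<le> len {A..B}"
    proof (rule measure_mono_fmeasurable)
      show "\<Union>F \<in> sets lborel"
        using fm F(2) by (intro sets.finite_Union) (auto simp: fmeasurable_def)
    qed (use fm AleB in \<open>auto simp: fmeasurable_def\<close>)
    also have "\<dots> = B - A" using AleB by simp
    finally have "real (card F) \<le> (B - A) / \<epsilon>" using assms(2) by (simp add: field_simps)
    then show "card F \<le> nat \<lfloor>(B - A) / \<epsilon>\<rfloor>" by linarith
  qed
qed

text \<open>Greedy choice: repeatedly pick an element of maximal weight among those left. Every element \<open>x\<close> is
  reached, since all elements picked before it belong to the finite set of those at least as heavy.\<close>

lemma antitone_enumeration_exists:
  fixes w :: "'a \<Rightarrow> real"
  assumes "infinite X" "\<And>x. x \<in> X \<Longrightarrow> finite {y \<in> X. w x \<le> w y}"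
  shows "\<exists>G :: nat \<Rightarrow> 'a. bij_betw G UNIV X \<and> (\<forall>m n. m \<le> n \<longrightarrow> w (G n) \<le> w (G m))"
proof -
  define pick where "pick Y = (SOME x. x \<in> Y \<and> (\<forall>y\<in>Y. w y \<le> w x))" for Y
  have pick: "pick Y \<in> Y \<and> (\<forall>y\<in>Y. w y \<le> w (pick Y))" if Y: "Y \<subseteq> X" "Y \<noteq> {}" for Y
  proof -
    obtain x0 where x0: "x0 \<in> Y" using Y by blast
    let ?Z = "{y \<in> Y. w x0 \<le> w y}"
    have "finite ?Z" using x0 Y by (intro finite_subset[OF _ assms(2)[of x0]]) auto
    then have fin: "finite (w ` ?Z)" and ne: "w ` ?Z \<noteq> {}" using x0 by auto
    obtain x where x: "x \<in> ?Z" "w x = Max (w ` ?Z)" using Max_in[OF fin ne] by auto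
    have "w y \<le> w x" if "y \<in> Y" for y
    proof (cases "w x0 \<le> w y")
      case True then show ?thesis using x(2) Max_ge[OF fin] that by auto
    next
      case False then show ?thesis using x(1) by auto
    qed
    then have "\<exists>x. x \<in> Y \<and> (\<forall>y\<in>Y. w y \<le> w x)" using x(1) by auto
    then show ?thesis unfolding pick_def by (rule someI_ex)
  qed
  define P where "P = rec_nat {} (\<lambda>_ Q. insert (pick (X - Q)) Q)"
  define G where "G n = pick (X - P n)" for n
  have P: "P n = G ` {..<n}" for n
    by (induction n) (auto simp: P_def G_def lessThan_Suc)
  have Gn: "G n \<in> X - P n \<and> (\<forall>y\<in>X - P n. w y \<le> w (G n))" for n
  proof -
    have "X - P n \<noteq> {}" using assms(1) P by (metis Diff_eq_empty_iff finite_imageI finite_lessThan finite_subset)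
    then show ?thesis unfolding G_def by (intro pick) auto
  qed
  have anti: "w (G n) \<le> w (G m)" if "m \<le> n" for m n
  proof -
    have "P m \<subseteq> P n" using that by (auto simp: P)
    then show ?thesis using Gn[of n] Gn[of m] by blast
  qed
  have "G m \<noteq> G n" if "m < n" for m n
    using Gn[of n] that unfolding P by (metis DiffD2 imageI lessThan_iff)
  then have inj: "inj G" by (metis injI linorder_neqE_nat)
  have "x \<in> range G" if x: "x \<in> X" for x
  proof (rule ccontr)
    assume "x \<notin> range G"
    then have "x \<in> X - P n" for n using x by (auto simp: P)
    then have "G n \<in> {y \<in> X. w x \<le> w y}" for n using Gn[of n] by auto
    then have "range G \<subseteq> {y \<in> X. w x \<le> w y}" by auto
    then show False using assms(2)[OF x] inj by (meson finite_imageD finite_subset infinite_UNIV_nat)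
  qed
  then have "range G = X" using Gn by auto
  then show ?thesis using inj anti by (auto simp: bij_betw_def)
qed

text \<open>Without this, the choice operator in \<^const>\<open>thickness\<close> could denote any sequence, and nothing
  would follow about \<^term>\<open>K\<close>.\<close>

lemma gap_enumeration_exists:
  assumes "cantor_set K"
  shows "\<exists>G. gap_enumeration K G"
proof -
  have K: "compact K" using assms by (simp add: cantor_set_def)
  have "finite {O'' \<in> gaps K. len O' \<le> len O''}" if gap: "O' \<in> gaps K" for O'
  proof -
    obtain c d where "is_gap K c d" "O' = {c<..<d}" using gaps_are_gap_intervals[OF K gap] .
    then have "len O' > 0" by (simp add: is_gap_def)
    then show ?thesis by (rule finite_long_gaps[OF K])
  qed
  then show ?thesis
    using antitone_enumeration_exists[OF infinite_gaps[OF assms], of len]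
    by (simp add: gap_enumeration_def)
qed

section \<open>Thickness as separation of gaps\<close>

text \<open>The gap \<^term>\<open>G n\<close> is a connected subset of the hull that is disjoint from all other gaps. So exactly one
  component contains it, and the definite description in \<^const>\<open>gap_host\<close> denotes this component.\<close>

lemma gap_host_props:
  assumes K: "compact K" and G: "gap_enumeration K G"
  shows "connected (gap_host K G n)" "G n \<subseteq> gap_host K G n"
    "gap_host K G n \<subseteq> convex hull K - (\<Union>m<n. G m)"
proof -
  let ?U = "convex hull K - (\<Union>m<n. G m)"
  have inj: "inj G" and rng: "\<And>m. G m \<in> gaps K"
    using G by (auto simp: gap_enumeration_def bij_betw_def)
  obtain c d where cd: "is_gap K c d" "G n = {c<..<d}"
    using gaps_are_gap_intervals[OF K rng] .
  have "{c..d} \<subseteq> convex hull K"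
  proof -
    have "c \<in> convex hull K" "d \<in> convex hull K" using cd(1) by (auto simp: is_gap_def hull_inc)
    then have "closed_segment c d \<subseteq> convex hull K" using closed_segment_subset convex_convex_hull by blast
    then show ?thesis using cd(1) by (simp add: is_gap_def closed_segment_eq_real_ivl)
  qed
  then have "G n \<subseteq> convex hull K" using cd by auto
  moreover have "G n \<inter> G m = {}" if "m < n" for m
  proof -
    have "G n \<noteq> G m" using inj that by (auto dest: injD)
    then show ?thesis using rng components_nonoverlap[of "G n" "- K" "G m"] by (auto simp: gaps_def)
  qed
  ultimately have sub: "G n \<subseteq> ?U" by auto
  have ne: "G n \<noteq> {}" and con: "connected (G n)"
    using cd by (auto simp: is_gap_def)
  obtain C where C: "C \<in> components ?U" "G n \<subseteq> C"
    using exists_component_superset[OF sub _ con] ne sub by blast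
  have "\<exists>!C. C \<in> components ?U \<and> G n \<subseteq> C"
  proof (rule ex1I[of _ C])
    fix C' assume "C' \<in> components ?U \<and> G n \<subseteq> C'"
    then show "C' = C" using components_nonoverlap[of C' ?U C] C ne by blast
  qed (use C in auto)
  then have "gap_host K G n \<in> components ?U \<and> G n \<subseteq> gap_host K G n"
    unfolding gap_host_def by (rule theI')
  then show "connected (gap_host K G n)" "G n \<subseteq> gap_host K G n" "gap_host K G n \<subseteq> ?U"
    by (auto dest: in_components_connected in_components_subset)
qed

text \<open>A set without measure gets the value \<open>0\<close>, so the bound also holds for it.\<close>

lemma len_le:
  assumes "T \<subseteq> {u..v}" "u \<le> v"
  shows "len T \<le> v - u"
proof (cases "T \<in> sets lborel")
  case True
  then have "len T \<le> len {u..v}" using assms by (intro measure_mono_fmeasurable) (auto simp: fmeasurable_def)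
  then show ?thesis using assms by simp
next
  case False
  then show ?thesis using assms by (simp add: measure_notin_sets del: sets_lborel)
qed

text \<open>Of two gaps, consider the one that is enumerated later, which is no longer than the other. Its host
  interval is connected and avoids the earlier gap, so the bridge facing that gap fits into the
  space between the two, and the length of the bridge is at least the thickness times the length of
  the shorter gap. Against the ends of the hull, the host simply lies in \<open>[A, B]\<close>.\<close>

lemma cantor_set_thick:
  assumes cantor: "cantor_set K" and hull: "convex hull K = {A..B}"
  shows "thick K A B (thickness K)"
proof -
  have K: "compact K" and ne: "K \<noteq> {}" using cantor by (auto simp: cantor_set_def)
  have KAB: "K \<subseteq> {A..B}" using hull hull_subset by metis
  have ends: "A \<in> K \<and> B \<in> K"
  proof -
    have bd: "bdd_above K" "bdd_below K"
      using K by (auto intro: bounded_imp_bdd_above bounded_imp_bdd_below compact_imp_bounded)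
    have in1: "Inf K \<in> K" "Sup K \<in> K"
      using K ne bd by (auto intro: closed_contains_Inf closed_contains_Sup compact_imp_closed)
    have "K \<subseteq> {Inf K..Sup K}" using bd by (auto intro: cInf_lower cSup_upper)
    then have "convex hull K \<subseteq> {Inf K..Sup K}" by (rule hull_minimal) simp
    moreover have "A \<le> B" using KAB ne by fastforce
    ultimately have "A \<in> {Inf K..Sup K}" "B \<in> {Inf K..Sup K}" using hull by auto
    moreover have "Inf K \<in> {A..B}" "Sup K \<in> {A..B}" using in1 KAB by auto
    ultimately have "A = Inf K" "B = Sup K" by auto
    with in1 show ?thesis by simp
  qed
  have AltB: "A < B"
  proof (rule ccontr)
    assume "\<not> A < B"
    then have "K \<subseteq> {A}" using KAB by auto
    then show False using cantor_infinite[OF cantor] finite_subset by blast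
  qed
  \<comment> \<open>Two gaps with a common end, or a gap at an end of the hull, would leave a point of
    \<open>K\<close> isolated.\<close>
  have nonisolated: False if x: "u < x" "x < v" "x \<in> K" "{u<..<v} \<inter> K \<subseteq> {x}" for u x v
  proof -
    have "x islimpt K" using cantor x(3) by (simp add: cantor_set_def)
    then obtain y where "y \<in> K" "y \<in> {u<..<v}" "y \<noteq> x"
      using x(1,2) islimptE[of x K "{u<..<v}"] by auto
    with x(4) show False by auto
  qed
  define G where "G = (SOME G. gap_enumeration K G)"
  have G: "gap_enumeration K G"
    unfolding G_def using gap_enumeration_exists[OF cantor] by (rule someI_ex)
  define q where "q n = min (len (left_bridge K G n)) (len (right_bridge K G n)) / len (G n)" for n
  have thickness_eq: "thickness K = (INF n. q n)"
    unfolding thickness_def Let_def G_def[symmetric] q_def ..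
  have q0: "q n \<ge> 0" for n unfolding q_def by (simp add: measure_nonneg)
  have tau0: "thickness K \<ge> 0" unfolding thickness_eq by (rule cINF_greatest) (use q0 in auto)
  have "bdd_below (range q)" using q0 by (rule bdd_belowI2)
  then have tau_q: "thickness K \<le> q n" for n
    unfolding thickness_eq by (rule cINF_lower) simp
  have bridge: "thickness K * (d - c) \<le> len (left_bridge K G n) \<and>
      thickness K * (d - c) \<le> len (right_bridge K G n)"
    if "is_gap K c d" "G n = {c<..<d}" for c d n
  proof -
    have "c < d" using that by (simp add: is_gap_def)
    then show ?thesis using tau_q[of n] that(2) unfolding q_def
      by (simp add: pos_le_divide_eq)
  qed
  have index: "\<exists>n. G n = {c<..<d}" if "is_gap K c d" for c d
  proof -
    have "{c<..<d} \<in> range G"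
      using is_gap_in_gaps[OF that] G by (simp add: gap_enumeration_def bij_betw_def)
    then show ?thesis by auto
  qed
  note host = gap_host_props[OF K G]
  have left: "thickness K * (d - c) \<le> c - u"
    if gap: "is_gap K c d" and n: "G n = {c<..<d}" and u: "gap_host K G n \<subseteq> {u..}" and "u \<le> c" for c d n u
  proof -
    have "x \<le> c" if "\<forall>y\<in>G n. x < y" for x
    proof (rule ccontr)
      assume "\<not> x \<le> c"
      moreover have "c < d" using gap by (simp add: is_gap_def)
      ultimately obtain y where "c < y" "y < min x d" using dense[of c "min x d"] by auto
      then show False using that n by force
    qed
    then have "left_bridge K G n \<subseteq> {u..c}" using u unfolding left_bridge_def by auto
    then show ?thesis using len_le[OF _ \<open>u \<le> c\<close>] bridge[OF gap n] by (meson order_trans)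
  qed
  have right: "thickness K * (d - c) \<le> v - d"
    if gap: "is_gap K c d" and n: "G n = {c<..<d}" and v: "gap_host K G n \<subseteq> {..v}" and "d \<le> v" for c d n v
  proof -
    have "d \<le> x" if "\<forall>y\<in>G n. y < x" for x
    proof (rule ccontr)
      assume "\<not> d \<le> x"
      moreover have "c < d" using gap by (simp add: is_gap_def)
      ultimately obtain y where "max x c < y" "y < d" using dense[of "max x c" d] by auto
      then show False using that n by force
    qed
    then have "right_bridge K G n \<subseteq> {d..v}" using v unfolding right_bridge_def by auto
    then show ?thesis using len_le[OF _ \<open>d \<le> v\<close>] bridge[OF gap n] by (meson order_trans)
  qed
  have hullgap: "A < c \<and> d < B \<and> thickness K * (d - c) \<le> c - A \<and> thickness K * (d - c) \<le> B - d"
    if gap: "is_gap K c d" for c d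
  proof -
    have cd: "c \<in> K" "d \<in> K" "c < d" "{c<..<d} \<inter> K = {}" using gap by (auto simp: is_gap_def)
    then have AcdB: "A \<le> c" "d \<le> B" using KAB by auto
    have "A \<noteq> c"
    proof
      assume "A = c"
      then have "x = c" if "x \<in> {c - 1<..<d} \<inter> K" for x
        using that cd(4) KAB by (cases "x \<le> c") (auto simp: disjoint_iff)
      then have "{c - 1<..<d} \<inter> K \<subseteq> {c}" by blast
      then show False using nonisolated[of "c - 1" c d] cd by simp
    qed
    moreover have "d \<noteq> B"
    proof
      assume "d = B"
      then have "x = d" if "x \<in> {c<..<d + 1} \<inter> K" for x
        using that cd(4) KAB by (cases "d \<le> x") (auto simp: disjoint_iff)
      then have "{c<..<d + 1} \<inter> K \<subseteq> {d}" by blast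
      then show False using nonisolated[of c d "d + 1"] cd by simp
    qed
    moreover obtain n where n: "G n = {c<..<d}" using index[OF gap] by blast
    moreover have "gap_host K G n \<subseteq> {A..}" "gap_host K G n \<subseteq> {..B}" using host(3)[of n] hull by auto
    ultimately show ?thesis using left[OF gap n] right[OF gap n] AcdB by auto
  qed
  have twogaps: "d < c' \<and> thickness K * min (d - c) (d' - c') \<le> c' - d"
    if gap: "is_gap K c d" and gap': "is_gap K c' d'" and "d \<le> c'" for c d c' d'
  proof -
    have cd: "c \<in> K" "d \<in> K" "c < d" "{c<..<d} \<inter> K = {}" using gap by (auto simp: is_gap_def)
    have cd': "c' \<in> K" "d' \<in> K" "c' < d'" "{c'<..<d'} \<inter> K = {}" using gap' by (auto simp: is_gap_def)
    have "d \<noteq> c'"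
    proof
      assume "d = c'"
      then have "x = d" if "x \<in> {c<..<d'} \<inter> K" for x
        using that cd(4) cd'(4) by (cases x d rule: linorder_cases) (auto simp: disjoint_iff)
      then have "{c<..<d'} \<inter> K \<subseteq> {d}" by blast
      then show False using nonisolated[of c d d'] cd cd' \<open>d = c'\<close> by simp
    qed
    then have lt: "d < c'" using \<open>d \<le> c'\<close> by simp
    obtain n m where n: "G n = {c<..<d}" and m: "G m = {c'<..<d'}" using index gap gap' by metis
    obtain z where z: "c < z" "z < d" using dense cd(3) by blast
    obtain z' where z': "c' < z'" "z' < d'" using dense cd'(3) by blast
    have zG: "z \<in> G n" "z' \<in> G m" using n m z z' by auto
    have "n \<noteq> m"
    proof
      assume "n = m"
      then have "z \<in> G m" using zG by simp
      then show False using m z lt by auto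
    qed
    then consider "n < m" | "m < n" by linarith
    then have "thickness K * min (d - c) (d' - c') \<le> c' - d"
    proof cases
      case 1
      have "x \<ge> d" if x: "x \<in> gap_host K G m" for x
      proof (rule ccontr)
        assume "\<not> x \<ge> d"
        then obtain y where y: "max x c < y" "y < d" using dense[of "max x c" d] cd(3) by auto
        have "y \<in> gap_host K G m"
          using connectedD_interval[OF host(1)[of m] x, of z' y] host(2)[of m] zG(2) y z' lt by auto
        then have "y \<notin> G n" using host(3)[of m] 1 by blast
        then show False using n y by simp
      qed
      then have *: "thickness K * (d' - c') \<le> c' - d"
        using left[OF gap' m, of d] lt by auto
      have "thickness K * min (d - c) (d' - c') \<le> thickness K * (d' - c')"
        using tau0 by (intro mult_left_mono) auto
      with * show ?thesis by simp
    next
      case 2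
      have "x \<le> c'" if x: "x \<in> gap_host K G n" for x
      proof (rule ccontr)
        assume "\<not> x \<le> c'"
        then obtain y where y: "c' < y" "y < min x d'" using dense[of c' "min x d'"] cd'(3) by auto
        have "y \<in> gap_host K G n"
          using connectedD_interval[OF host(1)[of n] _ x, of z y] host(2)[of n] zG(1) y z lt by auto
        then have "y \<notin> G m" using host(3)[of n] 2 by blast
        then show False using m y by simp
      qed
      then have *: "thickness K * (d - c) \<le> c' - d"
        using right[OF gap n, of c'] lt by auto
      have "thickness K * min (d - c) (d' - c') \<le> thickness K * (d - c)"
        using tau0 by (intro mult_left_mono) auto
      with * show ?thesis by simp
    qed
    with lt show ?thesis by simp
  qed
  show ?thesis unfolding thick_def
    using K KAB ends AltB tau0 hullgap twogaps by blast
qed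

section \<open>Reflection and finiteness\<close>

lemma finite_long_is_gap:
  assumes "compact K" "\<epsilon> > 0"
  shows "finite {(c, d). is_gap K c d \<and> \<epsilon> \<le> d - c}"
proof (rule finite_imageD)
  let ?P = "{(c, d). is_gap K c d \<and> \<epsilon> \<le> d - c}"
  let ?g = "\<lambda>(c::real, d). {c<..<d}"
  have "?g ` ?P \<subseteq> {O' \<in> gaps K. \<epsilon> \<le> len O'}"
    using is_gap_in_gaps by (fastforce simp: is_gap_def)
  then show "finite (?g ` ?P)" using finite_long_gaps[OF assms] finite_subset by blast
  show "inj_on ?g ?P"
  proof (rule inj_onI, clarify)
    fix c d c' d' assume "is_gap K c d" "is_gap K c' d'" and eq: "{c<..<d} = {c'<..<d'}"
    then have "c < d" "c' < d'" by (auto simp: is_gap_def)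
    then have "Inf {c<..<d} = c" "Sup {c<..<d} = d" "Inf {c'<..<d'} = c'" "Sup {c'<..<d'} = d'" by auto
    then show "c = c' \<and> d = d'" using eq by simp
  qed
qed

lemma is_gap_outside: "is_gap K c d \<Longrightarrow> x \<in> K \<Longrightarrow> x \<le> c \<or> d \<le> x"
  unfolding is_gap_def by (metis disjoint_iff greaterThanLessThan_iff not_le)

lemma is_gap_uminus: "is_gap (uminus ` K) c d \<longleftrightarrow> is_gap K (- d) (- c)"
proof -
  have mem: "x \<in> uminus ` K \<longleftrightarrow> - x \<in> K" for x :: real
    by (metis image_iff minus_minus)
  have "({c<..<d} \<inter> uminus ` K = {}) \<longleftrightarrow> ({- d<..<- c} \<inter> K = {})"
    by (force simp: disjoint_iff)
  then show ?thesis by (auto simp: is_gap_def mem)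
qed

lemma thick_uminus:
  assumes "thick K A B \<tau>"
  shows "thick (uminus ` K) (- B) (- A) \<tau>"
proof -
  note T = assms[unfolded thick_def]
  have "compact (uminus ` K)" using T compact_negations by blast
  moreover have "uminus ` K \<subseteq> {- B..- A}" using T by auto
  moreover have "- B < c \<and> d < - A \<and> \<tau> * (d - c) \<le> c - - B \<and> \<tau> * (d - c) \<le> - A - d"
    if "is_gap (uminus ` K) c d" for c d
  proof -
    have "is_gap K (- d) (- c)" using that by (simp add: is_gap_uminus)
    then have "A < - d \<and> - c < B \<and> \<tau> * (- c - - d) \<le> - d - A \<and> \<tau> * (- c - - d) \<le> B - - c"
      using T by blast
    then show ?thesis by (auto simp: algebra_simps)
  qed
  moreover have "d < c' \<and> \<tau> * min (d - c) (d' - c') \<le> c' - d"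
    if "is_gap (uminus ` K) c d \<and> is_gap (uminus ` K) c' d' \<and> d \<le> c'" for c d c' d'
  proof -
    have "is_gap K (- d) (- c)" "is_gap K (- d') (- c')" "- c' \<le> - d"
      using that by (auto simp: is_gap_uminus)
    then have "- c' < - d \<and> \<tau> * min (- c' - - d') (- c - - d) \<le> - d - - c'"
      using T by blast
    then show ?thesis by (auto simp: min.commute)
  qed
  ultimately show ?thesis using T unfolding thick_def by auto
qed

section \<open>Increasing functions on products of thick sets\<close>

text \<open>The situation after all coordinates have been oriented so that \<^term>\<open>f\<close> increases in each of them. The
  derivative enters only through \<open>growth\<close>, the thickness conditions only through \<open>balance\<close>. A gap of
  length \<open>l\<close> in direction \<open>i\<close> has weight \<open>\<omega>\<^sub>i l\<close>; weights decide in which order the gaps of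
  different coordinates are removed.\<close>

locale thick_product =
  fixes f :: "real ^ 'n \<Rightarrow> real" and K :: "'n \<Rightarrow> real set"
    and A B \<tau> \<omega> S L :: "'n \<Rightarrow> real"
  assumes thick: "\<And>i. thick (K i) (A i) (B i) (\<tau> i)"
    and weight_pos: "\<And>i. \<omega> i > 0"
    and S_pos: "\<And>i. S i > 0"
    and balance: "\<And>i. L i \<le> \<omega> i * (\<Sum>j\<in>UNIV - {i}. S j * \<tau> j / \<omega> j)"
    and growth: "\<And>x y. \<lbrakk>\<And>i. A i \<le> x $ i; \<And>i. x $ i \<le> y $ i; \<And>i. y $ i \<le> B i\<rbrakk> \<Longrightarrow>
        (\<Sum>i\<in>UNIV. S i * (y $ i - x $ i)) \<le> f y - f x \<and>
        f y - f x \<le> (\<Sum>i\<in>UNIV. L i * (y $ i - x $ i))"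
    and cont: "continuous_on {x. \<forall>i. x $ i \<in> {A i..B i}} f"
begin

lemma compact_K: "compact (K i)" and K_sub: "K i \<subseteq> {A i..B i}" and A_in: "A i \<in> K i"
  and B_in: "B i \<in> K i" and A_less_B: "A i < B i" and tau_nonneg: "\<tau> i \<ge> 0"
  using thick[of i] by (auto simp: thick_def)

lemma hull_gap:
  "is_gap (K i) c d \<Longrightarrow> A i < c \<and> d < B i \<and> \<tau> i * (d - c) \<le> c - A i \<and> \<tau> i * (d - c) \<le> B i - d"
  using thick[of i] by (simp add: thick_def)

lemma two_gaps:
  "is_gap (K i) c d \<Longrightarrow> is_gap (K i) c' d' \<Longrightarrow> d \<le> c' \<Longrightarrow>
     d < c' \<and> \<tau> i * min (d - c) (d' - c') \<le> c' - d"
  using thick[of i] unfolding thick_def by blast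

definition left_end :: "real \<Rightarrow> 'n \<Rightarrow> real \<Rightarrow> bool" where
  "left_end M i a \<longleftrightarrow> a = A i \<or> (\<exists>c. is_gap (K i) c a \<and> M \<le> \<omega> i * (a - c))"

definition right_end :: "real \<Rightarrow> 'n \<Rightarrow> real \<Rightarrow> bool" where
  "right_end M i b \<longleftrightarrow> b = B i \<or> (\<exists>d. is_gap (K i) b d \<and> M \<le> \<omega> i * (d - b))"

text \<open>A box of level \<^term>\<open>M\<close> is a product of pieces of the hulls whose bounding gaps have weight at least
  \<^term>\<open>M\<close> and whose inner gaps have weight at most \<^term>\<open>M\<close>. The two bounds overlap at \<^term>\<open>M\<close> so that gaps of
  equal weight can be removed one after the other.\<close>

definition gap_box :: "real \<Rightarrow> real ^ 'n \<Rightarrow> real ^ 'n \<Rightarrow> bool" where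
  "gap_box M a b \<longleftrightarrow> (\<forall>i. left_end M i (a $ i) \<and> right_end M i (b $ i) \<and> a $ i \<le> b $ i \<and>
     (\<forall>c d. is_gap (K i) c d \<and> a $ i \<le> c \<and> d \<le> b $ i \<longrightarrow> \<omega> i * (d - c) \<le> M))"

lemma left_end_in: "left_end M i a \<Longrightarrow> a \<in> K i"
  using A_in by (auto simp: left_end_def is_gap_def)

lemma right_end_in: "right_end M i b \<Longrightarrow> b \<in> K i"
  using B_in by (auto simp: right_end_def is_gap_def)

lemma ends_less:
  assumes "left_end M i a" "right_end M i b" "a \<le> b"
  shows "a < b"
  using assms A_less_B[of i] hull_gap[of i] two_gaps[of i]
  unfolding left_end_def right_end_def by blast

text \<open>A box is thick on the scale of its level: a side of it lies between two bounding gaps, or between one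
  and an end of the hull, and bounding gaps are at least as heavy as \<^term>\<open>M\<close>. A side without bounding gap
  is the full hull; there the hypothesis \<open>hull\<close> restricts the level instead.\<close>

lemma ends_apart:
  assumes ends: "left_end M i a" "right_end M i b" "a \<le> b"
    and hull: "\<tau> i * M \<le> \<omega> i * (B i - A i)"
  shows "\<tau> i * M \<le> \<omega> i * (b - a)"
proof -
  have scale: "\<tau> i * M \<le> \<omega> i * w" if "M \<le> \<omega> i * u" "\<tau> i * u \<le> w" for u w
  proof -
    have "\<tau> i * M \<le> \<tau> i * (\<omega> i * u)" using that(1) tau_nonneg by (rule mult_left_mono)
    also have "\<dots> = \<omega> i * (\<tau> i * u)" by simp
    also have "\<dots> \<le> \<omega> i * w" using that(2) weight_pos[of i] by simp
    finally show ?thesis .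
  qed
  consider "a = A i" "b = B i"
    | d where "a = A i" "is_gap (K i) b d" "M \<le> \<omega> i * (d - b)"
    | c where "is_gap (K i) c a" "M \<le> \<omega> i * (a - c)" "b = B i"
    | c d where "is_gap (K i) c a" "M \<le> \<omega> i * (a - c)" "is_gap (K i) b d" "M \<le> \<omega> i * (d - b)"
    using ends unfolding left_end_def right_end_def by blast
  then show ?thesis
  proof cases
    case 1 then show ?thesis using hull by simp
  next
    case 2 then show ?thesis using scale hull_gap by blast
  next
    case 3 then show ?thesis using scale hull_gap by blast
  next
    case 4
    have "M \<le> \<omega> i * min (a - c) (d - b)" using 4 by (simp add: min_def)
    then show ?thesis using scale two_gaps[OF 4(1,3) ends(3)] by blast
  qed
qed

lemma left_end_mono: "left_end M i a \<Longrightarrow> M' \<le> M \<Longrightarrow> left_end M' i a"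
  unfolding left_end_def by (meson order_trans)

lemma right_end_mono: "right_end M i b \<Longrightarrow> M' \<le> M \<Longrightarrow> right_end M' i b"
  unfolding right_end_def by (meson order_trans)

lemma box_in_hull:
  assumes "gap_box M a b" shows "A i \<le> a $ i" "a $ i \<le> b $ i" "b $ i \<le> B i"
  using assms K_sub[of i] left_end_in[of M i "a $ i"] right_end_in[of M i "b $ i"]
  by (auto simp: gap_box_def)

definition put :: "real ^ 'n \<Rightarrow> 'n \<Rightarrow> real \<Rightarrow> real ^ 'n" where
  "put x i c = (\<chi> j. if j = i then c else x $ j)"

lemma put_nth [simp]: "put x i c $ j = (if j = i then c else x $ j)"
  by (simp add: put_def)

text \<open>The heart of the proof. Between the two corners, the value of \<^term>\<open>f\<close> rises by at least
  \<open>S\<^sub>j (b\<^sub>j - a\<^sub>j)\<close> for each coordinate \<open>j \<noteq> i\<close> and drops by at most \<open>L\<^sub>i (d - c)\<close> across the gap. Since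
  the gap has weight \<^term>\<open>M\<close>, each side is at least \<open>\<tau>\<^sub>j M / \<omega>\<^sub>j\<close> long by \<open>ends_apart\<close>, and the
  hypothesis \<open>balance\<close> on the weights is just what makes the rise outweigh the drop.\<close>

lemma halves_overlap:
  assumes box: "gap_box M a b" and M: "\<And>j. \<tau> j * M \<le> \<omega> j * (B j - A j)"
    and gap: "is_gap (K i) c d" "a $ i \<le> c" "d \<le> b $ i" "\<omega> i * (d - c) = M"
  shows "f (put a i d) \<le> f (put b i c)"
proof -
  have cd: "c < d" using gap(1) by (simp add: is_gap_def)
  have ab: "A j \<le> a $ j" "a $ j \<le> b $ j" "b $ j \<le> B j" for j
    using box_in_hull[OF box] .
  have hc: "A i \<le> c" "d \<le> B i" using ab[of i] gap by auto
  have aB: "a $ j \<le> B j" and Ab: "A j \<le> b $ j" for j using ab[of j] by auto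
  \<comment> \<open>Compare both corners with their componentwise minimum \<open>?m\<close>.\<close>
  let ?p = "put b i c" and ?q = "put a i d" and ?m = "put a i c"
  have "f ?q - f ?m \<le> (\<Sum>j\<in>UNIV. L j * (?q $ j - ?m $ j))"
    by (rule conjunct2[OF growth]) (use ab aB hc cd in auto)
  also have "\<dots> = (\<Sum>j\<in>UNIV. if j = i then L i * (d - c) else 0)"
    by (intro sum.cong) auto
  also have "\<dots> = L i * (d - c)" by simp
  also have "\<dots> \<le> \<omega> i * (\<Sum>j\<in>UNIV - {i}. S j * \<tau> j / \<omega> j) * (d - c)"
    using balance[of i] cd by (intro mult_right_mono) auto
  also have "\<dots> = (\<Sum>j\<in>UNIV - {i}. S j * (\<tau> j * M / \<omega> j))"
    unfolding gap(4)[symmetric] sum_distrib_left sum_distrib_right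
    by (intro sum.cong) (auto simp: field_simps)
  also have "\<dots> \<le> (\<Sum>j\<in>UNIV - {i}. S j * (b $ j - a $ j))"
  proof (intro sum_mono mult_left_mono)
    fix j
    have "\<tau> j * M \<le> \<omega> j * (b $ j - a $ j)"
      by (rule ends_apart[OF _ _ _ M]) (use box in \<open>simp_all add: gap_box_def\<close>)
    then show "\<tau> j * M / \<omega> j \<le> b $ j - a $ j"
      using weight_pos[of j] by (simp add: pos_divide_le_eq mult.commute)
    show "0 \<le> S j" using S_pos[of j] by simp
  qed
  also have "\<dots> = (\<Sum>j\<in>UNIV. S j * (?p $ j - ?m $ j))"
    by (rule sum.mono_neutral_cong_left) auto
  also have "\<dots> \<le> f ?p - f ?m"
    by (rule conjunct1[OF growth]) (use ab Ab hc cd gap in auto)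
  finally show ?thesis by simp
qed

definition inner_gaps :: "real \<Rightarrow> real ^ 'n \<Rightarrow> real ^ 'n \<Rightarrow> ('n \<times> real \<times> real) set" where
  "inner_gaps s a b =
     {(i, c, d). is_gap (K i) c d \<and> a $ i \<le> c \<and> d \<le> b $ i \<and> s \<le> \<omega> i * (d - c)}"

lemma finite_inner_gaps:
  assumes "s > 0" shows "finite (inner_gaps s a b)"
proof -
  have "inner_gaps s a b \<subseteq> (SIGMA i:UNIV. {(c, d). is_gap (K i) c d \<and> s / \<omega> i \<le> d - c})"
    using weight_pos by (auto simp: inner_gaps_def pos_divide_le_eq mult.commute)
  moreover have "finite \<dots>"
    using assms weight_pos compact_K by (intro finite_SigmaI finite_long_is_gap) auto
  ultimately show ?thesis by (rule finite_subset)
qed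

text \<open>Cut along the heaviest inner gap. Its weight becomes the new level: the gap itself now bounds the
  two halves, and the old bounding gaps are at least as heavy. By \<open>halves_overlap\<close> the value \<open>t\<close> stays
  between the values at the lowest and the highest corner of one of the halves. As that half has
  lost an inner gap, finitely many cuts remove all gaps of weight at least \<open>s\<close>.\<close>

lemma refine_box:
  assumes "s > 0" "gap_box M a b" "\<And>j. \<tau> j * M \<le> \<omega> j * (B j - A j)" "f a \<le> t" "t \<le> f b"
  shows "\<exists>M' a' b'. gap_box M' a' b' \<and> inner_gaps s a' b' = {} \<and> f a' \<le> t \<and> t \<le> f b'"
  using assms
proof (induction "card (inner_gaps s a b)" arbitrary: M a b rule: less_induct)
  case less
  note s = less.prems(1) and box = less.prems(2) and hull = less.prems(3)
  note fin = finite_inner_gaps[OF s, of a b]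
  show ?case
  proof (cases "inner_gaps s a b = {}")
    case True
    then show ?thesis using less.prems by blast
  next
    case False
    let ?w = "\<lambda>(i, c, d). \<omega> i * (d - c)"
    define M' where "M' = Max (?w ` inner_gaps s a b)"
    have "M' \<in> ?w ` inner_gaps s a b" unfolding M'_def using fin False by (intro Max_in) auto
    then obtain i c d where gap: "is_gap (K i) c d" "a $ i \<le> c" "d \<le> b $ i" "s \<le> \<omega> i * (d - c)"
      and M': "\<omega> i * (d - c) = M'"
      by (auto simp: inner_gaps_def)
    have cd: "c < d" using gap(1) by (simp add: is_gap_def)
    have maximal: "\<omega> j * (d' - c') \<le> M'" if "is_gap (K j) c' d'" "a $ j \<le> c'" "d' \<le> b $ j" for j c' d'
    proof (cases "s \<le> \<omega> j * (d' - c')")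
      case True
      then have "(j, c', d') \<in> inner_gaps s a b" using that by (simp add: inner_gaps_def)
      then have "?w (j, c', d') \<in> ?w ` inner_gaps s a b" by (rule imageI)
      then show ?thesis unfolding M'_def using fin by (auto intro: Max_ge)
    next
      case False
      then show ?thesis using gap(4) M' by simp
    qed
    have "M' \<le> M" using box gap M' by (auto simp: gap_box_def)
    have hull': "\<tau> j * M' \<le> \<omega> j * (B j - A j)" for j
      using mult_left_mono[OF \<open>M' \<le> M\<close> tau_nonneg[of j]] hull[of j] by linarith
    have ends: "left_end M' j (a $ j)" "right_end M' j (b $ j)" "a $ j \<le> b $ j" for j
      using box \<open>M' \<le> M\<close> by (auto simp: gap_box_def intro: left_end_mono right_end_mono)
    have ends': "left_end M' i d" "right_end M' i c"
      using gap(1) M' by (auto simp: left_end_def right_end_def)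
    have cut: "a $ j \<le> put b i c $ j" "put b i c $ j \<le> b $ j" "right_end M' j (put b i c $ j)"
        "a $ j \<le> put a i d $ j" "put a i d $ j \<le> b $ j" "left_end M' j (put a i d $ j)" for j
      using ends[of j] ends' gap(2,3) cd by auto
    have boxes: "gap_box M' a b" "gap_box M' a (put b i c)" "gap_box M' (put a i d) b"
      unfolding gap_box_def using ends cut maximal order_trans[OF _ cut(2)] order_trans[OF cut(4)]
      by blast+
    have "(i, c, d) \<in> inner_gaps s a b" using gap by (simp add: inner_gaps_def)
    moreover have "(i, c, d) \<notin> inner_gaps s a (put b i c)" "(i, c, d) \<notin> inner_gaps s (put a i d) b"
      using cd by (auto simp: inner_gaps_def)
    moreover have "inner_gaps s a (put b i c) \<subseteq> inner_gaps s a b"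
        "inner_gaps s (put a i d) b \<subseteq> inner_gaps s a b"
      unfolding inner_gaps_def using order_trans[OF _ cut(2)] order_trans[OF cut(4)] by blast+
    ultimately have fewer: "card (inner_gaps s a (put b i c)) < card (inner_gaps s a b)"
        "card (inner_gaps s (put a i d) b) < card (inner_gaps s a b)"
      using fin by (blast intro: psubset_card_mono)+
    have "f (put a i d) \<le> f (put b i c)"
      using halves_overlap[OF boxes(1) hull' gap(1-3) M'] .
    then consider "t \<le> f (put b i c)" | "f (put a i d) \<le> t" by linarith
    then show ?thesis
    proof cases
      case 1
      then show ?thesis using less.hyps[OF fewer(1) s boxes(2) hull'] less.prems(4) by blast
    next
      case 2
      then show ?thesis using less.hyps[OF fewer(2) s boxes(3) hull'] less.prems(5) by blast
    qed
  qed
qed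

lemma compact_image: "compact (f ` {x. \<forall>i. x $ i \<in> K i})"
proof (rule compact_continuous_image)
  show "continuous_on {x. \<forall>i. x $ i \<in> K i} f"
    using cont by (rule continuous_on_subset) (use K_sub in blast)
  have "closed (\<Inter>i. (\<lambda>x :: real ^ 'n. x $ i) -` K i)"
    using compact_K by (intro closed_INT ballI closed_vimage continuous_intros compact_imp_closed)
  moreover have "(\<Inter>i. (\<lambda>x :: real ^ 'n. x $ i) -` K i) = {x. \<forall>i. x $ i \<in> K i}" by auto
  moreover have "{x. \<forall>i. x $ i \<in> K i} \<subseteq> cbox (\<chi> i. A i) (\<chi> i. B i)"
    using K_sub by (auto simp: mem_box_cart subset_iff)
  ultimately show "compact {x. \<forall>i. x $ i \<in> K i}"
    by (metis bounded_cbox bounded_subset compact_eq_bounded_closed)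
qed

text \<open>For each \<open>s\<close>, refinement leaves a box around \<open>t\<close> all of whose inner gaps have weight less than \<open>s\<close>.
  The intermediate value theorem gives a point \<open>x\<close> of this box with \<open>f x = t\<close>, and moving each
  coordinate of \<open>x\<close> down to \<open>K\<^sub>i\<close> changes it by at most \<open>s / \<omega>\<^sub>i\<close>. So \<open>t\<close> is a limit of values of
  \<^term>\<open>f\<close> on the product of the sets, and the set of these values is compact.\<close>

lemma box_image:
  assumes box: "gap_box M a b" and hull: "\<And>j. \<tau> j * M \<le> \<omega> j * (B j - A j)"
    and t: "f a \<le> t" "t \<le> f b"
  shows "t \<in> f ` {x. \<forall>i. x $ i \<in> K i}"
proof -
  let ?F = "f ` {x. \<forall>i. x $ i \<in> K i}"
  define C where "C = (\<Sum>i\<in>UNIV. \<bar>L i\<bar> / \<omega> i)"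
  have C0: "C \<ge> 0" unfolding C_def using weight_pos by (intro sum_nonneg) (simp add: less_imp_le)
  have near: "\<exists>u\<in>?F. \<bar>u - t\<bar> \<le> C * s" if s: "s > 0" for s
  proof -
    obtain M' a' b' where box': "gap_box M' a' b'" and none: "inner_gaps s a' b' = {}"
      and t': "f a' \<le> t" "t \<le> f b'"
      using refine_box[OF s box hull t] by blast
    note h = box_in_hull[OF box']
    have "a' \<in> cbox a' b'" "b' \<in> cbox a' b'" using h by (auto simp: mem_box_cart)
    moreover have "continuous_on (cbox a' b') f"
    proof (rule continuous_on_subset[OF cont])
      show "cbox a' b' \<subseteq> {x. \<forall>i. x $ i \<in> {A i..B i}}"
        using order_trans[OF h(1)] order_trans[OF _ h(3)] by (auto simp: mem_box_cart)
    qed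
    then have "connected (f ` cbox a' b')"
      using convex_connected[OF convex_box(1)] by (rule connected_continuous_image)
    ultimately have "t \<in> f ` cbox a' b'" using t' connectedD_interval by blast
    then obtain x where x: "x \<in> cbox a' b'" "f x = t" by blast
    have xi: "a' $ i \<le> x $ i" "x $ i \<le> b' $ i" for i using x(1) by (auto simp: mem_box_cart)
    have "\<exists>k\<in>K i. a' $ i \<le> k \<and> k \<le> x $ i \<and> \<omega> i * (x $ i - k) \<le> s" for i
    proof (cases "x $ i \<in> K i")
      case True
      then show ?thesis using xi s by (intro bexI[of _ "x $ i"]) auto
    next
      case False
      have "a' $ i \<in> K i" "b' $ i \<in> K i"
        using box' left_end_in[of M' i] right_end_in[of M' i] by (auto simp: gap_box_def)
      then obtain c d where cd: "is_gap (K i) c d" "a' $ i \<le> c" "c < x $ i" "x $ i < d" "d \<le> b' $ i"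
        using gap_around[of "K i" "a' $ i" "b' $ i" "x $ i"] compact_imp_closed[OF compact_K] xi False
        by metis
      have "(i, c, d) \<notin> inner_gaps s a' b'" using none by simp
      then have "\<omega> i * (d - c) < s" using cd by (simp add: inner_gaps_def)
      moreover have "\<omega> i * (x $ i - c) \<le> \<omega> i * (d - c)" using weight_pos[of i] cd by simp
      ultimately show ?thesis using cd by (intro bexI[of _ c]) (auto simp: is_gap_def)
    qed
    then obtain k where k: "\<And>i. k i \<in> K i" "\<And>i. a' $ i \<le> k i" "\<And>i. k i \<le> x $ i"
      "\<And>i. \<omega> i * (x $ i - k i) \<le> s" by metis
    let ?k = "\<chi> i. k i"
    have g: "(\<Sum>i\<in>UNIV. S i * (x $ i - ?k $ i)) \<le> f x - f ?k \<and>
        f x - f ?k \<le> (\<Sum>i\<in>UNIV. L i * (x $ i - ?k $ i))"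
    proof (rule growth)
      show "A i \<le> ?k $ i" for i using h(1)[of i] k(2)[of i] by simp
      show "?k $ i \<le> x $ i" for i using k(3)[of i] by simp
      show "x $ i \<le> B i" for i using h(3)[of i] xi(2)[of i] by simp
    qed
    have "0 \<le> (\<Sum>i\<in>UNIV. S i * (x $ i - ?k $ i))"
      using S_pos k by (intro sum_nonneg mult_nonneg_nonneg) (auto simp: less_imp_le)
    moreover have "(\<Sum>i\<in>UNIV. L i * (x $ i - ?k $ i)) \<le> (\<Sum>i\<in>UNIV. \<bar>L i\<bar> / \<omega> i * s)"
    proof (rule sum_mono)
      fix i
      have "L i * (x $ i - ?k $ i) \<le> \<bar>L i\<bar> * (x $ i - k i)"
        using k(3)[of i] by (simp add: mult_right_mono)
      also have "\<dots> \<le> \<bar>L i\<bar> * (s / \<omega> i)"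
        using k(4)[of i] weight_pos[of i] by (intro mult_left_mono) (auto simp: pos_le_divide_eq mult.commute)
      finally show "L i * (x $ i - ?k $ i) \<le> \<bar>L i\<bar> / \<omega> i * s" by simp
    qed
    ultimately have "\<bar>f ?k - t\<bar> \<le> C * s"
      using g x(2) by (simp add: C_def sum_distrib_right)
    moreover have "f ?k \<in> ?F" using k(1) by auto
    ultimately show ?thesis by blast
  qed
  have "t \<in> closure ?F"
    unfolding closure_approachable
  proof (intro allI impI)
    fix e :: real assume e: "e > 0"
    obtain u where u: "u \<in> ?F" "\<bar>u - t\<bar> \<le> C * (e / (C + 1))"
      using near[of "e / (C + 1)"] e C0 by auto
    have "C * (e / (C + 1)) < e" using e C0 by (simp add: field_simps)
    with u show "\<exists>y\<in>?F. dist y t < e" by (auto simp: dist_real_def)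
  qed
  then show ?thesis using compact_imp_closed[OF compact_image] by (simp add: closure_closed)
qed

lemma finite_left_ends:
  assumes "M > 0" shows "finite {a. left_end M i a}"
proof -
  have "{a. left_end M i a} \<subseteq> insert (A i) (snd ` {(c, d). is_gap (K i) c d \<and> M / \<omega> i \<le> d - c})"
    using weight_pos[of i] by (force simp: left_end_def pos_divide_le_eq mult.commute)
  moreover have "finite \<dots>" using assms weight_pos[of i] compact_K
    by (intro finite.insertI finite_imageI finite_long_is_gap) auto
  ultimately show ?thesis by (rule finite_subset)
qed

lemma finite_right_ends:
  assumes "M > 0" shows "finite {b. right_end M i b}"
proof -
  have "{b. right_end M i b} \<subseteq> insert (B i) (fst ` {(c, d). is_gap (K i) c d \<and> M / \<omega> i \<le> d - c})"
    using weight_pos[of i] by (force simp: right_end_def pos_divide_le_eq mult.commute)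
  moreover have "finite \<dots>" using assms weight_pos[of i] compact_K
    by (intro finite.insertI finite_imageI finite_long_is_gap) auto
  ultimately show ?thesis by (rule finite_subset)
qed

lemma finite_boxes:
  assumes "M > 0" shows "finite {(a, b). gap_box M a b}"
proof -
  have fin: "finite {x :: real ^ 'n. \<forall>i. x $ i \<in> X i}" if "\<And>i. finite (X i)" for X
  proof -
    have "finite (vec_nth -` (Pi\<^sub>E UNIV X) :: (real ^ 'n) set)"
      using that by (intro finite_vimageI finite_PiE) (auto simp: inj_def vec_eq_iff)
    moreover have "vec_nth -` (Pi\<^sub>E UNIV X) = {x :: real ^ 'n. \<forall>i. x $ i \<in> X i}"
      by (auto simp: PiE_def)
    ultimately show ?thesis by simp
  qed
  have "{(a, b). gap_box M a b} \<subseteq>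
      {a. \<forall>i. a $ i \<in> {a. left_end M i a}} \<times> {b. \<forall>i. b $ i \<in> {b. right_end M i b}}"
    by (auto simp: gap_box_def)
  moreover have "finite \<dots>"
    by (intro finite_cartesian_product fin finite_left_ends finite_right_ends assms)
  ultimately show ?thesis by (rule finite_subset)
qed

text \<open>In each coordinate take the nearest admissible ends on both sides of \<open>x\<close>. A gap of weight above \<open>M\<close>
  between them would have an admissible end even nearer to \<open>x\<close>.\<close>

lemma covered_by_box:
  assumes "M > 0" and x: "\<And>i. x $ i \<in> K i"
  obtains a b where "gap_box M a b" "\<And>i. a $ i \<le> x $ i" "\<And>i. x $ i \<le> b $ i"
proof -
  have "\<exists>a b. left_end M i a \<and> right_end M i b \<and> a \<le> x $ i \<and> x $ i \<le> b \<and>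
      (\<forall>c d. is_gap (K i) c d \<and> a \<le> c \<and> d \<le> b \<longrightarrow> \<omega> i * (d - c) \<le> M)" for i
  proof -
    have xi: "A i \<le> x $ i" "x $ i \<le> B i" using x[of i] K_sub[of i] by auto
    let ?l = "{a. left_end M i a \<and> a \<le> x $ i}" and ?r = "{b. right_end M i b \<and> x $ i \<le> b}"
    have fl: "finite ?l" "?l \<noteq> {}"
      using finite_left_ends[OF assms(1), of i] xi by (auto simp: left_end_def)
    have fr: "finite ?r" "?r \<noteq> {}"
      using finite_right_ends[OF assms(1), of i] xi by (auto simp: right_end_def)
    have l: "Max ?l \<in> ?l" and r: "Min ?r \<in> ?r" using Max_in[OF fl] Min_in[OF fr] by blast+
    have "\<omega> i * (d - c) \<le> M" if gap: "is_gap (K i) c d" "Max ?l \<le> c" "d \<le> Min ?r" for c d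
    proof (rule ccontr)
      assume "\<not> \<omega> i * (d - c) \<le> M"
      then have e: "left_end M i d" "right_end M i c"
        using gap(1) by (auto simp: left_end_def right_end_def)
      have cd: "c < d" "x $ i \<le> c \<or> d \<le> x $ i"
        using gap(1) x[of i] is_gap_outside by (auto simp: is_gap_def)
      show False
      proof (cases "d \<le> x $ i")
        case True
        then have "d \<le> Max ?l" using e fl by (intro Max_ge) auto
        then show False using gap(2) cd by simp
      next
        case False
        then have "Min ?r \<le> c" using e fr cd by (intro Min_le) auto
        then show False using gap(3) cd by simp
      qed
    qed
    with l r show ?thesis by blast
  qed
  then obtain a b where ab: "\<And>i. left_end M i (a i) \<and> right_end M i (b i) \<and> a i \<le> x $ i \<and> x $ i \<le> b i \<and>
      (\<forall>c d. is_gap (K i) c d \<and> a i \<le> c \<and> d \<le> b i \<longrightarrow> \<omega> i * (d - c) \<le> M)" by metis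
  show ?thesis
  proof (rule that[of "\<chi> i. a i" "\<chi> i. b i"])
    show "gap_box M (\<chi> i. a i) (\<chi> i. b i)"
      unfolding gap_box_def using ab order_trans[OF conjunct1[OF conjunct2[OF conjunct2[OF ab]]]] by auto
  qed (use ab in auto)
qed

lemma growth_strict:
  assumes "\<And>i. A i \<le> x $ i" "\<And>i. x $ i < y $ i" "\<And>i. y $ i \<le> B i"
  shows "f x < f y"
proof -
  have "0 < (\<Sum>i\<in>UNIV. S i * (y $ i - x $ i))"
    using assms(2) S_pos by (intro sum_pos) auto
  also have "\<dots> \<le> f y - f x" by (rule conjunct1[OF growth]) (use assms in \<open>auto simp: less_imp_le\<close>)
  finally show ?thesis by simp
qed

lemma growth_mono:
  assumes "\<And>i. A i \<le> x $ i" "\<And>i. x $ i \<le> y $ i" "\<And>i. y $ i \<le> B i"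
  shows "f x \<le> f y"
proof -
  have "0 \<le> (\<Sum>i\<in>UNIV. S i * (y $ i - x $ i))"
    using assms(2) S_pos by (intro sum_nonneg mult_nonneg_nonneg) (auto simp: less_imp_le)
  also have "\<dots> \<le> f y - f x" by (rule conjunct1[OF growth]) (use assms in auto)
  finally show ?thesis by simp
qed

text \<open>The level \<open>\<delta>\<close> is chosen so small that the hulls meet the requirement of \<open>ends_apart\<close>. The finitely
  many boxes of level \<open>\<delta>\<close> cover the product of the sets, and \<open>box_image\<close> turns the image of each of
  them into an interval.\<close>

theorem image_finite_union:
  "\<exists>\<J>. finite \<J> \<and> (\<forall>J\<in>\<J>. \<exists>a b. a < b \<and> J = {a..b}) \<and> f ` {x. \<forall>i. x $ i \<in> K i} = \<Union>\<J>"
proof -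
  \<comment> \<open>The summand \<open>1\<close> keeps the denominator positive when \<open>\<tau>\<^sub>i\<close> is \<open>0\<close>.\<close>
  define \<delta> where "\<delta> = Min (range (\<lambda>i. \<omega> i * (B i - A i) / (\<tau> i + 1)))"
  have term_pos: "\<omega> i * (B i - A i) / (\<tau> i + 1) > 0" for i
    using weight_pos[of i] A_less_B[of i] tau_nonneg[of i] by simp
  have "\<delta> > 0" unfolding \<delta>_def using term_pos by simp
  have hull: "\<tau> i * \<delta> \<le> \<omega> i * (B i - A i)" for i
  proof -
    have "\<delta> \<le> \<omega> i * (B i - A i) / (\<tau> i + 1)" unfolding \<delta>_def by (intro Min_le) auto
    then have "\<delta> * (\<tau> i + 1) \<le> \<omega> i * (B i - A i)"
      using tau_nonneg[of i] by (simp add: pos_le_divide_eq)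
    then show ?thesis using \<open>\<delta> > 0\<close> by (simp add: algebra_simps)
  qed
  define \<J> where "\<J> = (\<lambda>(a, b). {f a..f b}) ` {(a, b). gap_box \<delta> a b}"
  have "finite \<J>" unfolding \<J>_def using finite_boxes[OF \<open>\<delta> > 0\<close>] by simp
  moreover have "\<exists>u v. u < v \<and> J = {u..v}" if J: "J \<in> \<J>" for J
  proof -
    obtain a b where ab: "gap_box \<delta> a b" "J = {f a..f b}" using J by (auto simp: \<J>_def)
    have "a $ i < b $ i" for i using ab(1) by (auto simp: gap_box_def intro!: ends_less[of \<delta> i])
    then have "f a < f b" using box_in_hull[OF ab(1)] by (intro growth_strict) auto
    with ab show ?thesis by blast
  qed
  moreover have "f ` {x. \<forall>i. x $ i \<in> K i} = \<Union>\<J>"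
  proof (intro equalityI subsetI)
    fix t assume "t \<in> f ` {x. \<forall>i. x $ i \<in> K i}"
    then obtain x where x: "\<And>i. x $ i \<in> K i" "t = f x" by auto
    obtain a b where ab: "gap_box \<delta> a b" "\<And>i. a $ i \<le> x $ i" "\<And>i. x $ i \<le> b $ i"
      using covered_by_box[OF \<open>\<delta> > 0\<close> x(1)] by blast
    note h = box_in_hull[OF ab(1)]
    have xh: "A i \<le> x $ i" "x $ i \<le> B i" for i using x(1)[of i] K_sub[of i] by auto
    have "f a \<le> f x" using h(1) ab(2) xh(2) by (rule growth_mono)
    moreover have "f x \<le> f b" using xh(1) ab(3) h(3) by (rule growth_mono)
    ultimately show "t \<in> \<Union>\<J>" using ab(1) x(2) by (auto simp: \<J>_def)
  next
    fix t assume "t \<in> \<Union>\<J>"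
    then obtain a b where "gap_box \<delta> a b" "f a \<le> t" "t \<le> f b" by (auto simp: \<J>_def)
    then show "t \<in> f ` {x. \<forall>i. x $ i \<in> K i}" using box_image hull by blast
  qed
  ultimately show ?thesis by blast
qed

end

section \<open>Weights and partial derivatives\<close>

text \<open>Both conditions of the theorem say that suitable weights exist. The first is the case of equal
  weights. For the second, substitute \<open>\<mu>\<^sub>j = S\<^sub>j \<tau>\<^sub>j / \<omega>\<^sub>j\<close>: the required inequality then reads
  \<open>\<mu>\<^sub>i \<le> (\<tau>\<^sub>i / (\<tau>\<^sub>i + r\<^sub>i)) \<Sum>\<^sub>j \<mu>\<^sub>j\<close>, which is solved by \<open>\<mu>\<^sub>i = \<tau>\<^sub>i / (\<tau>\<^sub>i + r\<^sub>i)\<close> because the sum of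
  these numbers is at least \<open>1\<close>. Hence \<open>\<omega>\<^sub>i = S\<^sub>i \<tau>\<^sub>i + L\<^sub>i\<close>, which is positive even if \<open>\<tau>\<^sub>i = 0\<close>.\<close>

lemma balancing_weights:
  fixes S L r \<tau> :: "'n::finite \<Rightarrow> real"
  assumes S: "\<And>i. S i > 0" and L: "\<And>i. L i > 0" and \<tau>: "\<And>i. \<tau> i \<ge> 0"
    and r: "\<And>i. r i = L i / S i"
    and cond: "(\<forall>i. L i \<le> (\<Sum>j\<in>UNIV - {i}. S j * \<tau> j)) \<or> (\<Sum>i\<in>UNIV. \<tau> i / (\<tau> i + r i)) \<ge> 1"
  shows "\<exists>\<omega>. (\<forall>i. \<omega> i > 0) \<and> (\<forall>i. L i \<le> \<omega> i * (\<Sum>j\<in>UNIV - {i}. S j * \<tau> j / \<omega> j))"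
  using cond
proof
  assume "\<forall>i. L i \<le> (\<Sum>j\<in>UNIV - {i}. S j * \<tau> j)"
  then show ?thesis by (intro exI[of _ "\<lambda>_. 1"]) simp
next
  assume sum1: "(\<Sum>i\<in>UNIV. \<tau> i / (\<tau> i + r i)) \<ge> 1"
  define \<omega> where "\<omega> i = S i * \<tau> i + L i" for i
  have \<omega>: "\<omega> i > 0" for i
    unfolding \<omega>_def using S[of i] L[of i] \<tau>[of i] by (simp add: add_nonneg_pos)
  have share: "\<tau> i / (\<tau> i + r i) = S i * \<tau> i / \<omega> i" for i
  proof -
    have "\<omega> i = S i * (\<tau> i + r i)" unfolding \<omega>_def r using S[of i] by (simp add: field_simps)
    then show ?thesis using S[of i] by simp
  qed
  have "L i \<le> \<omega> i * (\<Sum>j\<in>UNIV - {i}. S j * \<tau> j / \<omega> j)" for i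
  proof -
    have "1 \<le> S i * \<tau> i / \<omega> i + (\<Sum>j\<in>UNIV - {i}. S j * \<tau> j / \<omega> j)"
      using sum1 unfolding share by (simp add: sum.remove[of UNIV i])
    then have "\<omega> i * 1 \<le> \<omega> i * (S i * \<tau> i / \<omega> i + (\<Sum>j\<in>UNIV - {i}. S j * \<tau> j / \<omega> j))"
      using \<omega>[of i] by (intro mult_left_mono) auto
    also have "\<dots> = S i * \<tau> i + \<omega> i * (\<Sum>j\<in>UNIV - {i}. S j * \<tau> j / \<omega> j)"
      using \<omega>[of i] by (simp add: distrib_left)
    finally show ?thesis by (simp add: \<omega>_def)
  qed
  with \<omega> show ?thesis by blast
qed

lemma partial_deriv_eq:
  fixes f :: "real ^ 'n \<Rightarrow> real"
  assumes "(f has_derivative F) (at x)"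
  shows "partial_deriv i f x = F (axis i 1)"
proof -
  have "((\<lambda>t. x + t *\<^sub>R axis i 1) has_derivative (\<lambda>t. t *\<^sub>R axis i 1)) (at 0)"
    by (auto intro!: derivative_eq_intros)
  moreover have "(f has_derivative F) (at (x + 0 *\<^sub>R axis i 1))" using assms by simp
  ultimately have "((\<lambda>t. f (x + t *\<^sub>R axis i 1)) has_derivative (\<lambda>t. F (t *\<^sub>R axis i 1))) (at 0)"
    by (rule has_derivative_compose)
  moreover have "F (t *\<^sub>R axis i 1) = F (axis i 1) * t" for t
    using linear_scale[OF has_derivative_linear[OF assms]] by simp
  ultimately have "((\<lambda>t. f (x + t *\<^sub>R axis i 1)) has_field_derivative F (axis i 1)) (at 0)"
    by (simp add: has_field_derivative_def)
  then show ?thesis unfolding partial_deriv_def by (rule DERIV_imp_deriv)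
qed

text \<open>The mean value theorem along the segment from \<^term>\<open>u\<close> to \<^term>\<open>v\<close>. A single intermediate point serves all
  coordinates, so bounds on the partial derivatives give both estimates of \<open>growth\<close> at once.\<close>

lemma mean_value_partial_deriv:
  fixes f :: "real ^ 'n \<Rightarrow> real"
  assumes diff: "\<And>x. (f has_derivative F x) (at x)" and "convex D" "u \<in> D" "v \<in> D"
  obtains \<xi> where "\<xi> \<in> D" "f v - f u = (\<Sum>i\<in>UNIV. partial_deriv i f \<xi> * (v $ i - u $ i))"
proof -
  have lin: "F x w = (\<Sum>i\<in>UNIV. partial_deriv i f x * w $ i)" for x w
  proof -
    have "w = (\<Sum>i\<in>UNIV. w $ i *\<^sub>R axis i 1)"
      using basis_expansion[of w] by (simp add: scalar_mult_eq_scaleR)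
    then have "F x w = F x (\<Sum>i\<in>UNIV. w $ i *\<^sub>R axis i 1)" by simp
    also have "\<dots> = (\<Sum>i\<in>UNIV. partial_deriv i f x * w $ i)"
      using has_derivative_linear[OF diff[of x]]
      by (simp add: linear_sum linear_scale partial_deriv_eq[OF diff[of x]] mult.commute)
    finally show ?thesis .
  qed
  let ?p = "\<lambda>t. u + t *\<^sub>R (v - u)"
  have "((\<lambda>t. f (?p t)) has_field_derivative F (?p t) (v - u)) (at t)" for t
  proof -
    have "(?p has_derivative (\<lambda>h. h *\<^sub>R (v - u))) (at t)"
      by (auto intro!: derivative_eq_intros)
    then have "((\<lambda>t. f (?p t)) has_derivative (\<lambda>h. F (?p t) (h *\<^sub>R (v - u)))) (at t)"
      using diff by (rule has_derivative_compose)
    moreover have "F (?p t) (h *\<^sub>R (v - u)) = F (?p t) (v - u) * h" for h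
      using linear_scale[OF has_derivative_linear[OF diff]] by simp
    ultimately show ?thesis by (simp add: has_field_derivative_def)
  qed
  then obtain z where z: "0 < z" "z < 1" "f (?p 1) - f (?p 0) = (1 - 0) * F (?p z) (v - u)"
    using MVT2[of 0 1 "\<lambda>t. f (?p t)" "\<lambda>t. F (?p t) (v - u)"] by auto
  have "?p z = (1 - z) *\<^sub>R u + z *\<^sub>R v" by (simp add: algebra_simps)
  then have "?p z \<in> D" using convexD[OF assms(2-4), of "1 - z" z] z by simp
  moreover have "f v - f u = (\<Sum>i\<in>UNIV. partial_deriv i f (?p z) * (v $ i - u $ i))"
    using z(3) by (simp add: lin)
  ultimately show ?thesis using that by blast
qed

lemma nonvanishing_constant_sign:
  fixes g :: "'a::topological_space \<Rightarrow> real"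
  assumes "continuous_on D g" "connected D" "\<And>x. x \<in> D \<Longrightarrow> g x \<noteq> 0" "x \<in> D" "y \<in> D"
  shows "sgn (g x) = sgn (g y)"
proof (rule ccontr)
  assume "sgn (g x) \<noteq> sgn (g y)"
  then have "g x \<le> 0 \<and> 0 \<le> g y \<or> g y \<le> 0 \<and> 0 \<le> g x" by (auto simp: sgn_if split: if_splits)
  moreover have "connected (g ` D)" using assms(1,2) by (rule connected_continuous_image)
  ultimately have "0 \<in> g ` D" using assms(4,5) connectedD_interval by blast
  then show False using assms(3) by auto
qed

section \<open>Images of products of Cantor sets\<close>

theorem theorem1p15:
  fixes f :: "real ^ 'n \<Rightarrow> real"
    and K :: "'n \<Rightarrow> real set"
    and A B L S r :: "'n \<Rightarrow> real"
    and D :: "(real ^ 'n) set"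
  assumes "CARD('n) \<ge> 2"
    and "C1 f"
    and "\<And>i. cantor_set (K i)"
    and "\<And>i. convex hull (K i) = {A i..B i}"
    and "D = {x. \<forall>i. x $ i \<in> {A i..B i}}"
    and "\<And>i x. x \<in> D \<Longrightarrow> \<bar>partial_deriv i f x\<bar> > 0"
    and "\<And>i. L i = max_partial f D i"
    and "\<And>i. S i = min_partial f D i"
    and "\<And>i. r i = L i / S i"
    and "(\<forall>i. L i \<le> (\<Sum>j\<in>UNIV - {i}. S j * thickness (K j))) \<or>
         (\<Sum>i\<in>UNIV. thickness (K i) / (thickness (K i) + r i)) \<ge> 1"
  shows "\<exists>\<J>. finite \<J> \<and> (\<forall>J\<in>\<J>. \<exists>a b. a < b \<and> J = {a..b}) \<and>
           f ` {x. \<forall>i. x $ i \<in> K i} = \<Union>\<J>"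
proof -
  obtain F :: "real ^ 'n \<Rightarrow> (real ^ 'n) \<Rightarrow>\<^sub>L real"
    where diff: "\<And>x. (f has_derivative blinfun_apply (F x)) (at x)" and contF: "continuous_on UNIV F"
    using assms(2) by (auto simp: C1_def)
  have thickK: "thick (K i) (A i) (B i) (thickness (K i))" for i
    by (rule cantor_set_thick[OF assms(3,4)])
  then have AB: "A i < B i" and \<tau>: "thickness (K i) \<ge> 0" for i by (auto simp: thick_def)
  have D_cbox: "D = cbox (\<chi> i. A i) (\<chi> i. B i)"
    unfolding assms(5) by (auto simp: mem_box_cart)
  have D: "compact D" "convex D" "connected D"
    unfolding D_cbox by (simp_all add: convex_box convex_connected)
  define x\<^sub>0 :: "real ^ 'n" where "x\<^sub>0 = (\<chi> i. A i)"
  have x0: "x\<^sub>0 \<in> D" using AB by (simp add: assms(5) x\<^sub>0_def less_imp_le)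
  have cont_partial: "continuous_on D (partial_deriv i f)" for i
  proof -
    have "partial_deriv i f = (\<lambda>x. F x (axis i 1))"
      using partial_deriv_eq[OF diff] by (intro ext)
    then show ?thesis
      using continuous_on_subset[OF contF subset_UNIV] by (auto intro!: continuous_intros)
  qed
  then have cont_abs: "continuous_on D (\<lambda>x. \<bar>partial_deriv i f x\<bar>)" for i
    by (intro continuous_intros)
  have le_L: "\<bar>partial_deriv i f x\<bar> \<le> L i" if "x \<in> D" for i x
  proof -
    have "compact ((\<lambda>x. \<bar>partial_deriv i f x\<bar>) ` D)"
      using cont_abs D(1) by (rule compact_continuous_image)
    then show ?thesis unfolding assms(7) max_partial_def
      using that by (intro cSUP_upper bounded_imp_bdd_above compact_imp_bounded)
  qed
  have S_le: "S i \<le> \<bar>partial_deriv i f x\<bar>" if "x \<in> D" for i x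
    unfolding assms(8) min_partial_def using that by (intro cINF_lower bdd_belowI2[of _ 0]) auto
  have S_pos: "S i > 0" for i
  proof -
    obtain z where z: "z \<in> D" "\<And>y. y \<in> D \<Longrightarrow> \<bar>partial_deriv i f z\<bar> \<le> \<bar>partial_deriv i f y\<bar>"
      using continuous_attains_inf[OF D(1) _ cont_abs[of i]] x0 by blast
    have "\<bar>partial_deriv i f z\<bar> \<le> S i"
      unfolding assms(8) min_partial_def using x0 z by (intro cINF_greatest) auto
    then show ?thesis using assms(6)[OF z(1), of i] by linarith
  qed
  have L_pos: "L i > 0" for i
    using S_pos[of i] S_le[OF x0, of i] le_L[OF x0, of i] by linarith
  obtain \<omega> where \<omega>: "\<And>i. \<omega> i > 0"
    "\<And>i. L i \<le> \<omega> i * (\<Sum>j\<in>UNIV - {i}. S j * thickness (K j) / \<omega> j)"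
    using balancing_weights[where \<tau> = "\<lambda>i. thickness (K i)", OF S_pos L_pos \<tau> assms(9) assms(10)]
    by blast
  \<comment> \<open>Reflect the coordinates in which \<open>f\<close> decreases; the composite with the reflection \<open>R\<close>
    increases in all of them and has the same bounds \<open>S\<close> and \<open>L\<close>.\<close>
  define \<sigma> where "\<sigma> i = sgn (partial_deriv i f x\<^sub>0)" for i
  have \<sigma>: "\<sigma> i = 1 \<or> \<sigma> i = -1" for i
    using assms(6)[OF x0, of i] by (auto simp: \<sigma>_def sgn_if)
  have \<sigma>_partial: "partial_deriv i f x * \<sigma> i = \<bar>partial_deriv i f x\<bar>" if "x \<in> D" for i x
  proof -
    have "partial_deriv i f y \<noteq> 0" if "y \<in> D" for y using assms(6)[OF that, of i] by simp
    then have "sgn (partial_deriv i f x\<^sub>0) = sgn (partial_deriv i f x)"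
      using nonvanishing_constant_sign[OF cont_partial D(3) _ x0 that] by blast
    then show ?thesis by (simp add: \<sigma>_def abs_sgn)
  qed
  define R :: "real ^ 'n \<Rightarrow> real ^ 'n" where "R x = (\<chi> i. \<sigma> i * x $ i)" for x
  have R_nth [simp]: "R x $ i = \<sigma> i * x $ i" for x i by (simp add: R_def)
  have RR: "R (R x) = x" for x
  proof -
    have "\<sigma> i * (\<sigma> i * x $ i) = x $ i" for i using \<sigma>[of i] by auto
    then show ?thesis by (simp add: vec_eq_iff)
  qed
  define K' where "K' i = (if \<sigma> i = 1 then K i else uminus ` K i)" for i
  define A' where "A' i = (if \<sigma> i = 1 then A i else - B i)" for i
  define B' where "B' i = (if \<sigma> i = 1 then B i else - A i)" for i
  have R_hull: "R x \<in> D" if "\<And>i. A' i \<le> x $ i" "\<And>i. x $ i \<le> B' i" for x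
  proof -
    have "\<sigma> i * x $ i \<in> {A i..B i}" for i
      using that[of i] \<sigma>[of i] by (auto simp: A'_def B'_def split: if_splits)
    then show ?thesis by (simp add: assms(5))
  qed
  interpret thick_product "f \<circ> R" K' A' B' "\<lambda>i. thickness (K i)" \<omega> S L
  proof
    show "thick (K' i) (A' i) (B' i) (thickness (K i))" for i
      using thickK[of i] thick_uminus[OF thickK[of i]] by (simp add: K'_def A'_def B'_def)
    show "\<omega> i > 0" "S i > 0" "L i \<le> \<omega> i * (\<Sum>j\<in>UNIV - {i}. S j * thickness (K j) / \<omega> j)" for i
      using \<omega> S_pos by auto
    fix x y :: "real ^ 'n"
    assume xy: "\<And>i. A' i \<le> x $ i" "\<And>i. x $ i \<le> y $ i" "\<And>i. y $ i \<le> B' i"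
    have "R x \<in> D" "R y \<in> D"
      using order_trans[OF xy(2,3)] order_trans[OF xy(1,2)] xy(1,3) by (auto intro: R_hull)
    then obtain \<xi> where \<xi>: "\<xi> \<in> D"
      "f (R y) - f (R x) = (\<Sum>i\<in>UNIV. partial_deriv i f \<xi> * (R y $ i - R x $ i))"
      using mean_value_partial_deriv[OF diff D(2)] by metis
    have "f (R y) - f (R x) = (\<Sum>i\<in>UNIV. \<bar>partial_deriv i f \<xi>\<bar> * (y $ i - x $ i))"
      unfolding \<xi>(2) \<sigma>_partial[OF \<xi>(1), symmetric] by (intro sum.cong) (auto simp: algebra_simps)
    moreover have "(\<Sum>i\<in>UNIV. S i * (y $ i - x $ i)) \<le> (\<Sum>i\<in>UNIV. \<bar>partial_deriv i f \<xi>\<bar> * (y $ i - x $ i))"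
      using S_le[OF \<xi>(1)] xy(2) by (intro sum_mono mult_right_mono) auto
    moreover have "(\<Sum>i\<in>UNIV. \<bar>partial_deriv i f \<xi>\<bar> * (y $ i - x $ i)) \<le> (\<Sum>i\<in>UNIV. L i * (y $ i - x $ i))"
      using le_L[OF \<xi>(1)] xy(2) by (intro sum_mono mult_right_mono) auto
    ultimately show "(\<Sum>i\<in>UNIV. S i * (y $ i - x $ i)) \<le> (f \<circ> R) y - (f \<circ> R) x \<and>
        (f \<circ> R) y - (f \<circ> R) x \<le> (\<Sum>i\<in>UNIV. L i * (y $ i - x $ i))"
      by simp
  next
    have "continuous_on UNIV f"
      by (intro continuous_at_imp_continuous_on ballI has_derivative_continuous[OF diff])
    moreover have "continuous_on X R" for X
      unfolding R_def by (intro continuous_intros continuous_on_vec_lambda)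
    ultimately show "continuous_on {x. \<forall>i. x $ i \<in> {A' i..B' i}} (f \<circ> R)"
      by (meson continuous_on_compose continuous_on_subset subset_UNIV)
  qed
  have mem: "y \<in> K' i \<longleftrightarrow> \<sigma> i * y \<in> K i" for y i
    using \<sigma>[of i] by (auto simp: K'_def image_iff) (metis minus_minus)
  have "f ` {x. \<forall>i. x $ i \<in> K i} = (f \<circ> R) ` {x. \<forall>i. x $ i \<in> K' i}"
  proof (intro equalityI subsetI)
    fix t assume "t \<in> f ` {x. \<forall>i. x $ i \<in> K i}"
    then obtain x where x: "\<And>i. x $ i \<in> K i" "t = f x" by auto
    have "R x $ i \<in> K' i" for i
      unfolding mem using x(1)[of i] by (metis RR R_nth)
    then show "t \<in> (f \<circ> R) ` {x. \<forall>i. x $ i \<in> K' i}"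
      using x(2) by (intro image_eqI[of _ _ "R x"]) (auto simp: RR simp del: R_nth)
  qed (auto simp: mem)
  then show ?thesis using image_finite_union by simp
qed

end
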